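(* Let $f:\mathcal{X}\to\{0,1\}$ with $\mathcal{X}\subseteq\mathbb{R}^d$, let $\mathbf{x}\in\mathcal{X}$ satisfy $f(\mathbf{x})=0$, let $[\mathbf{a}^i,\mathbf{b}^i]$ ($i=1,\dots,d$) be the normal ranges of the features, and let $\mathcal{N}_0$ be the set of abnormal features of $\mathbf{x}$. Let $\mathcal{A}_1,\dots,\mathcal{A}_k$ be all the (pairwise distinct) minimal satisfiable subsets of $\mathcal{N}_0$, with $k\ge 2$, and let $\mathbf{c}_i=r(\mathbf{x},\mathcal{A}_i)$, $i=1,\dots,k$, be the corresponding counterfactual explanations. Then the count-diversity of $\mathbf{c}_1,\dots,\mathbf{c}_k$ is bounded below by $\frac{2}{d}$, i.e. $$\frac{2}{k(k-1)d}\sum_{i=1}^{k-1}\sum_{j=i+1}^{k}\sum_{l=1}^{d}\mathds{1}_{[\mathbf{c}_i^l\neq \mathbf{c}_j^l]}\;\ge\;\frac{2}{d}.$$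
   Context: Superscripts denote coordinates: $\mathbf{x}^i$ is the $i$-th feature value of $\mathbf{x}\in\mathbb{R}^d$. The prediction $1$ is the desired (favorable) one and $0$ the undesired one. Let $\mathcal{N}=\{1,\dots,d\}$. Each feature $i$ has a given normal range $[\mathbf{a}^i,\mathbf{b}^i]\subset\mathbb{R}$ with $\mathbf{a}^i\le\mathbf{b}^i$. The set of abnormal features of $\mathbf{x}$ is $\mathcal{N}_0=\{i\in\mathcal{N}:\mathbf{x}^i\notin[\mathbf{a}^i,\mathbf{b}^i]\}$. For $\mathcal{A}\subseteq\mathcal{N}_0$, the feature replacement $r(\mathbf{x},\mathcal{A})\in\mathbb{R}^d$ replaces every feature in $\mathcal{A}$ by the closest endpoint of its normal range and keeps all others: $r(\mathbf{x},\mathcal{A})^i=\mathbf{a}^i$ if $i\in\mathcal{A}$ and $\mathbf{x}^i<\mathbf{a}^i$; $r(\mathbf{x},\mathcal{A})^i=\mathbf{b}^i$ if $i\in\mathcal{A}$ and $\mathbf{x}^i>\mathbf{b}^i$; $r(\mathbf{x},\mathcal{A})^i=\mathbf{x}^i$ otherwise. It is understood that $r(\mathbf{x},\mathcal{A})\in\mathcal{X}$ for all $\mathcal{A}\subseteq\mathcal{N}_0$. A subset $\mathcal{A}\subseteq\mathcal{N}_0$ is satisfiable if $f(r(\mathbf{x},\mathcal{A}))=1$. It is a minimal satisfiable subset if it is satisfiable and no proper subset of it is satisfiable (minimality is with respect to inclusion, not cardinality). The counterfactual explanation associated with a minimal satisfiable subset $\mathcal{A}^*$ is $r(\mathbf{x},\mathcal{A}^*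 )$. $\mathds{1}_{[P]}$ equals $1$ if $P$ holds and $0$ otherwise. *)

theory Defs
  imports "HOL-Analysis.Analysis"
begin

text \<open>
  Feature vectors are elements of \<^typ>\<open>real ^ 'n\<close>; the finite type \<open>'n\<close> is the set of
  features, and \<open>d = CARD('n)\<close>. The vectors \<open>a\<close> and \<open>b\<close> hold the lower and upper endpoints
  of the normal ranges.
\<close>

definition abnormal_features :: "real ^ 'n \<Rightarrow> real ^ 'n \<Rightarrow> real ^ 'n \<Rightarrow> 'n set" where
  "abnormal_features a b x = {i. x $ i \<notin> {a $ i .. b $ i}}"

definition replacement ::
  "real ^ 'n \<Rightarrow> real ^ 'n \<Rightarrow> real ^ 'n \<Rightarrow> 'n set \<Rightarrow> real ^ 'n" where
  "replacement a b x A =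
    (\<chi> i. if i \<in> A \<and> x $ i < a $ i then a $ i
         else if i \<in> A \<and> x $ i > b $ i then b $ i
         else x $ i)"

definition satisfiable ::
  "(real ^ 'n \<Rightarrow> nat) \<Rightarrow> real ^ 'n \<Rightarrow> real ^ 'n \<Rightarrow> real ^ 'n \<Rightarrow> 'n set \<Rightarrow> bool" where
  "satisfiable f a b x A \<longleftrightarrow>
    A \<subseteq> abnormal_features a b x \<and> f (replacement a b x A) = 1"

definition minimal_satisfiable ::
  "(real ^ 'n \<Rightarrow> nat) \<Rightarrow> real ^ 'n \<Rightarrow> real ^ 'n \<Rightarrow> real ^ 'n \<Rightarrow> 'n set \<Rightarrow> bool" where
  "minimal_satisfiable f a b x A \<longleftrightarrow>
    satisfiable f a b x A \<and> (\<forall>B. B \<subset> A \<longrightarrow> \<not> satisfiable f a b x B)"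

definition count_diversity :: "nat \<Rightarrow> (nat \<Rightarrow> real ^ 'n) \<Rightarrow> real" where
  "count_diversity k c =
    2 / (real k * (real k - 1) * real CARD('n)) *
    (\<Sum>i = 1..k - 1. \<Sum>j = i + 1..k. \<Sum>l\<in>UNIV. of_bool (c i $ l \<noteq> c j $ l))"

end

theory Submission
  imports Defs
begin

text \<open>
  Minimal satisfiable subsets form an antichain under inclusion, so any two of them differ in at
  least two features, one from each set difference. Replacement really changes every abnormal
  feature, hence the two counterfactuals differ in each of these features, and every one of the
  \<open>k (k - 1) / 2\<close> pairs contributes at least \<open>2\<close> to the sum.
\<close>

text \<open>An abnormal value lies strictly outside its range, so moving it to an endpoint really
  changes it.\<close>

lemma replacement_neq_iff:
  assumes "B \<subseteq> abnormal_features a b x"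
  shows "replacement a b x B $ l \<noteq> x $ l \<longleftrightarrow> l \<in> B"
  using assms by (auto simp: replacement_def abnormal_features_def)

text \<open>Otherwise \<open>B\<close> would be a satisfiable proper subset of \<open>C\<close>,
  against the minimality of \<open>C\<close>.\<close>

lemma minimal_satisfiable_not_subset:
  assumes "minimal_satisfiable f a b x B" "minimal_satisfiable f a b x C" "B \<noteq> C"
  shows "\<not> B \<subseteq> C"
  using assms unfolding minimal_satisfiable_def by blast

lemma two_differing_features:
  assumes B: "minimal_satisfiable f a b x B"
    and C: "minimal_satisfiable f a b x C"
    and neq: "B \<noteq> C"
  shows "2 \<le> (\<Sum>l\<in>UNIV. of_bool (replacement a b x B $ l \<noteq> replacement a b x C $ l) :: real)"
proof -
  obtain p q where pq: "p \<in> B" "p \<notin> C" "q \<in> C" "q \<notin> B"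
    using minimal_satisfiable_not_subset[OF B C neq]
      minimal_satisfiable_not_subset[OF C B neq[symmetric]] by blast
  define D where "D = {l. replacement a b x B $ l \<noteq> replacement a b x C $ l}"
  have "B \<subseteq> abnormal_features a b x" "C \<subseteq> abnormal_features a b x"
    using B C by (auto simp: minimal_satisfiable_def satisfiable_def)
  note changed = replacement_neq_iff[OF this(1)] replacement_neq_iff[OF this(2)]
  \<comment> \<open>At \<open>p\<close> only the replacement along \<open>B\<close> departs from
    \<open>x\<close>, at \<open>q\<close> only the one along \<open>C\<close>.\<close>
  have "p \<in> D" "q \<in> D"
    using changed[of p] changed[of q] pq unfolding D_def by force+
  then have "{p, q} \<subseteq> D"
    by simp
  then have "card {p, q} \<le> card D"
    by (intro card_mono) auto
  moreover have "p \<noteq> q"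
    using pq by blast
  ultimately show ?thesis
    by (simp add: D_def flip: sum.inter_filter)
qed

text \<open>Counts the pairs i < j: the inner sum has k - i terms.\<close>

lemma sum_pairs_const:
  fixes r :: real
  shows "(\<Sum>i = 1..k - 1. \<Sum>j = i + 1..k. r) = real k * (real k - 1) / 2 * r"
proof -
  \<comment> \<open>The upper limit \<open>n\<close> is decoupled from \<open>k\<close>, so that the
    induction can keep \<open>k\<close> fixed.\<close>
  have *: "(\<Sum>i = 1..n. real k - real i) = real k * real n - real n * (real n + 1) / 2" for n
    by (induction n) (auto simp: field_simps)
  have "(\<Sum>i = 1..k - 1. \<Sum>j = i + 1..k. r) = (\<Sum>i = 1..k - 1. (real k - real i) * r)"
    by (rule sum.cong) (auto simp: of_nat_diff)
  also have "\<dots> = (\<Sum>i = 1..k - 1. real k - real i) * r"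
    by (rule sum_distrib_right[symmetric])
  \<comment> \<open>Here \<open>n\<close> is \<open>k - 1\<close> on naturals; the case
    \<open>k = 0\<close>, where it truncates to 0, gives zero on both sides.\<close>
  also have "(\<Sum>i = 1..k - 1. real k - real i) = real k * (real k - 1) / 2"
    unfolding * by (cases k) (auto simp: field_simps)
  finally show ?thesis .
qed

text \<open>Up to the factor 1/d, count-diversity is the average number of differing features over
  all pairs, so a bound valid for each pair passes to the average.\<close>

lemma count_diversity_ge:
  fixes c :: "nat \<Rightarrow> real ^ 'n"
  assumes "k \<ge> 2"
    and "\<And>i j. i \<in> {1..k} \<Longrightarrow> j \<in> {1..k} \<Longrightarrow> i \<noteq> j \<Longrightarrow>
      r \<le> (\<Sum>l\<in>UNIV. of_bool (c i $ l \<noteq> c j $ l))"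
  shows "count_diversity k c \<ge> r / real CARD('n)"
proof -
  have "real k * (real k - 1) / 2 * r \<le>
      (\<Sum>i = 1..k - 1. \<Sum>j = i + 1..k. \<Sum>l\<in>UNIV. of_bool (c i $ l \<noteq> c j $ l))"
    unfolding sum_pairs_const[symmetric] by (intro sum_mono assms(2)) auto
  then have "2 / (real k * (real k - 1) * real CARD('n)) * (real k * (real k - 1) / 2 * r) \<le>
      count_diversity k c"
    unfolding count_diversity_def using assms(1) by (intro mult_left_mono) auto
  \<comment> \<open>These let the number of pairs cancel against the normalising factor.\<close>
  moreover have "real k \<noteq> 0" "real k - 1 \<noteq> 0"
    using assms(1) by auto
  ultimately show ?thesis
    by simp
qed

theorem theorem1:
  fixes X :: "(real ^ 'n) set"
    and f :: "real ^ 'n \<Rightarrow> nat"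
    and x a b :: "real ^ 'n"
    and A :: "nat \<Rightarrow> 'n set"
    and c :: "nat \<Rightarrow> real ^ 'n"
    and k :: nat
  assumes "f \<in> X \<rightarrow> {0, 1}"
    and "x \<in> X"
    and "f x = 0"
    and "\<And>i. a $ i \<le> b $ i"
    and "\<And>B. B \<subseteq> abnormal_features a b x \<Longrightarrow> replacement a b x B \<in> X"
    and "bij_betw A {1..k} {B. minimal_satisfiable f a b x B}"
    and "k \<ge> 2"
    and "\<And>i. i \<in> {1..k} \<Longrightarrow> c i = replacement a b x (A i)"
  shows "count_diversity k c \<ge> 2 / real CARD('n)"
proof (rule count_diversity_ge[OF \<open>k \<ge> 2\<close>])
  fix i j
  assume ij: "i \<in> {1..k}" "j \<in> {1..k}" "i \<noteq> j"
  \<comment> \<open>Distinctness of the two subsets comes from injectivity of the enumeration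
    \<open>A\<close>.\<close>
  have "minimal_satisfiable f a b x (A i)" "minimal_satisfiable f a b x (A j)" "A i \<noteq> A j"
    using assms(6) ij by (auto simp: bij_betw_def inj_on_eq_iff)
  then show "2 \<le> (\<Sum>l\<in>UNIV. of_bool (c i $ l \<noteq> c j $ l) :: real)"
    using two_differing_features assms(8) ij by simp
qed

end
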